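(* Let $w\in\mathbb{R}^p$ and $\rho>0$, and assume $g_r(w)\neq 0$ and $q(w)\neq 0$. Then the problem $$\max_{\|\delta\|_2\le\rho}\; g_f(w)^\top\delta\qquad\text{subject to}\quad g_r(w)^\top\delta=0$$ (over $\delta\in\mathbb{R}^p$) admits a unique maximizer, namely $$\delta_{\mathrm{rosu}}(w)=\rho\,\frac{q(w)}{\|q(w)\|_2},$$ and its optimal value is $\rho\,\|q(w)\|_2$.
   Context: $L_f,L_r:\mathbb{R}^p\to\mathbb{R}$ are differentiable functions (forget and retain losses), with gradients $g_f(w)=\nabla L_f(w)$ and $g_r(w)=\nabla L_r(w)$. For $g_r(w)\ne 0$, put $P_r(w)=\dfrac{g_r(w)g_r(w)^\top}{\|g_r(w)\|_2^2}$ and $q(w)=(I-P_r(w))g_f(w)$. *)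

theory Defs
  imports "HOL-Analysis.Analysis"
begin

definition grad :: "('a::real_inner \<Rightarrow> real) \<Rightarrow> 'a \<Rightarrow> 'a"
  where "grad L w = (THE g. GDERIV L w :> g)"

lemma GDERIV_grad:
  fixes L :: "'a::euclidean_space \<Rightarrow> real"
  assumes "L differentiable (at w)"
  shows "GDERIV L w :> grad L w"
proof -
  obtain D where D: "(L has_derivative D) (at w)"
    using assms unfolding differentiable_def by blast
  interpret bounded_linear D
    using D by (rule has_derivative_bounded_linear)
  define g where "g = (\<Sum>b\<in>Basis. D b *\<^sub>R b)"
  have "D h = h \<bullet> g" for h
  proof -
    have "D h = D (\<Sum>b\<in>Basis. (h \<bullet> b) *\<^sub>R b)"
      by (simp add: euclidean_representation)
    also have "\<dots> = (\<Sum>b\<in>Basis. (h \<bullet> b) * D b)"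
      by (simp add: sum scaleR)
    also have "\<dots> = h \<bullet> g"
      by (simp add: g_def inner_sum_right mult.commute)
    finally show ?thesis .
  qed
  then have g: "GDERIV L w :> g"
    using D unfolding gderiv_def by (metis (full_types) ext)
  have "g' = g" if "GDERIV L w :> g'" for g'
  proof -
    have "(\<lambda>h. h \<bullet> g') = (\<lambda>h. h \<bullet> g)"
      using that g unfolding gderiv_def by (rule has_derivative_unique)
    then have "\<forall>h. h \<bullet> g' = h \<bullet> g"
      by meson
    then show ?thesis
      by (metis vector_eq_ldot)
  qed
  then show ?thesis
    unfolding grad_def using g by (metis theI)
qed

text \<open>The type \<open>real^1^'p\<close> is that of \<open>p \<times> 1\<close> matrices, so the product below is the
  outer product of the gradient with itself. It is meaningful only where the gradient is nonzero.\<close>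

definition retain_proj :: "(real^'p \<Rightarrow> real) \<Rightarrow> real^'p \<Rightarrow> real^'p^'p"
  where "retain_proj L\<^sub>r w =
    (1 / (norm (grad L\<^sub>r w))\<^sup>2) *\<^sub>R
      ((columnvector (grad L\<^sub>r w) :: real^1^'p) ** (rowvector (grad L\<^sub>r w) :: real^'p^1))"

definition forget_dir :: "(real^'p \<Rightarrow> real) \<Rightarrow> (real^'p \<Rightarrow> real) \<Rightarrow> real^'p \<Rightarrow> real^'p"
  where "forget_dir L\<^sub>f L\<^sub>r w = (mat 1 - retain_proj L\<^sub>r w) *v grad L\<^sub>f w"

definition rosu_step :: "(real^'p \<Rightarrow> real) \<Rightarrow> (real^'p \<Rightarrow> real) \<Rightarrow> real \<Rightarrow> real^'p \<Rightarrow> real^'p"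
  where "rosu_step L\<^sub>f L\<^sub>r \<rho> w =
    \<rho> *\<^sub>R ((1 / norm (forget_dir L\<^sub>f L\<^sub>r w)) *\<^sub>R forget_dir L\<^sub>f L\<^sub>r w)"

definition feasible :: "(real^'p \<Rightarrow> real) \<Rightarrow> real \<Rightarrow> real^'p \<Rightarrow> (real^'p) set"
  where "feasible L\<^sub>r \<rho> w = {\<delta>. norm \<delta> \<le> \<rho> \<and> grad L\<^sub>r w \<bullet> \<delta> = 0}"

end

(* On the hyperplane orthogonal to the retain gradient the objective agrees with the inner product
   with q, since the forget gradient differs from q by a multiple of the retain gradient. As q lies
   in that hyperplane, Cauchy-Schwarz gives the optimal value, and its equality case gives
   uniqueness. *)
theory Submission
  imports Defs
begin

text \<open>Replaces the matrix projector by vector algebra: the outer product of a vector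
  \<open>g\<close> with itself sends \<open>f\<close> to
  \<open>(g \<bullet> f) *\<^sub>R g\<close>.\<close>

lemma forget_dir_eq:
  fixes w :: "real^'p"
  shows "forget_dir L\<^sub>f L\<^sub>r w =
    grad L\<^sub>f w - ((grad L\<^sub>r w \<bullet> grad L\<^sub>f w) / (norm (grad L\<^sub>r w))\<^sup>2) *\<^sub>R grad L\<^sub>r w"
proof -
  have "((columnvector g :: real^1^'p) ** (rowvector g :: real^'p^1)) *v f = (g \<bullet> f) *\<^sub>R g"
    for g f :: "real^'p"
    by (simp add: vec_eq_iff matrix_vector_mult_def matrix_matrix_mult_def columnvector_def
        rowvector_def inner_vec_def sum_distrib_left ac_simps)
  then show ?thesis
    by (simp add: forget_dir_def retain_proj_def matrix_vector_mult_diff_rdistrib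
        flip: scaleR_matrix_vector_assoc)
qed

lemma forget_dir_orthogonal:
  "grad L\<^sub>r w \<bullet> forget_dir L\<^sub>f L\<^sub>r w = 0"
  \<comment> \<open>For a nonzero retain gradient the squared norm cancels against the inner product
    of the gradient with itself; for a zero one the left factor vanishes.\<close>
  by (cases "grad L\<^sub>r w = 0")
    (simp_all add: forget_dir_eq inner_diff_right power2_norm_eq_inner)

lemma inner_grad_eq_inner_forget_dir:
  assumes "grad L\<^sub>r w \<bullet> \<delta> = 0"
  shows "grad L\<^sub>f w \<bullet> \<delta> = forget_dir L\<^sub>f L\<^sub>r w \<bullet> \<delta>"
  using assms by (simp add: forget_dir_eq inner_diff_left)

lemma inner_le_on_ball:
  fixes q \<delta> :: "'a::real_inner"
  assumes "norm \<delta> \<le> \<rho>"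
  shows "q \<bullet> \<delta> \<le> \<rho> * norm q"
proof -
  have "q \<bullet> \<delta> \<le> norm q * norm \<delta>"
    by (rule norm_cauchy_schwarz)
  also have "\<dots> \<le> \<rho> * norm q"
    using assms by (simp add: mult.commute mult_right_mono)
  finally show ?thesis .
qed

text \<open>Equality case of Cauchy-Schwarz in quantitative form: with \<open>u\<close> the unit
  vector along \<open>q\<close>, the squared distance from \<open>\<delta>\<close> to
  \<open>\<rho> *\<^sub>R u\<close> is at most
  \<open>\<rho>\<^sup>2 - 2 * \<rho>\<^sup>2 + \<rho>\<^sup>2 = 0\<close>.\<close>

lemma inner_ge_on_ball_imp_eq:
  fixes q \<delta> :: "'a::real_inner"
  assumes "norm \<delta> \<le> \<rho>" and "q \<noteq> 0" and "\<rho> * norm q \<le> q \<bullet> \<delta>"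
  shows "\<delta> = \<rho> *\<^sub>R ((1 / norm q) *\<^sub>R q)"
proof -
  define u where "u = (1 / norm q) *\<^sub>R q"
  have "0 \<le> \<rho>"
    using assms(1) norm_ge_zero order_trans by blast
  have "norm u = 1"
    using assms(2) by (simp add: u_def)
  have "\<rho> \<le> u \<bullet> \<delta>"
    using assms(2,3) by (simp add: u_def field_simps)
  \<comment> \<open>Scaling by \<open>\<rho>\<close> produces the cross term of the expanded square
    below.\<close>
  then have *: "\<rho> * \<rho> \<le> \<rho> * (u \<bullet> \<delta>)"
    using \<open>0 \<le> \<rho>\<close> by (rule mult_left_mono)
  have **: "\<delta> \<bullet> \<delta> \<le> \<rho> * \<rho>"
    using power_mono[OF assms(1) norm_ge_zero, of 2]
    by (simp only: power2_norm_eq_inner) (simp add: power2_eq_square)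
  have "u \<bullet> u = 1"
    using \<open>norm u = 1\<close> by (simp add: norm_eq_1)
  then have "(\<delta> - \<rho> *\<^sub>R u) \<bullet> (\<delta> - \<rho> *\<^sub>R u) = \<delta> \<bullet> \<delta> - 2 * (\<rho> * (u \<bullet> \<delta>)) + \<rho> * \<rho>"
    by (simp add: inner_diff_left inner_diff_right inner_commute)
  then have "(\<delta> - \<rho> *\<^sub>R u) \<bullet> (\<delta> - \<rho> *\<^sub>R u) \<le> 0"
    using * ** by linarith
  then have "\<delta> - \<rho> *\<^sub>R u = 0"
    by (metis inner_gt_zero_iff not_less)
  then show ?thesis
    by (simp add: u_def)
qed

theorem proposition1:
  fixes L\<^sub>f L\<^sub>r :: "real^'p \<Rightarrow> real"
    and w :: "real^'p"
    and \<rho> :: real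
  assumes "\<And>v. L\<^sub>f differentiable (at v)"
    and "\<And>v. L\<^sub>r differentiable (at v)"
    and "\<rho> > 0"
    and "grad L\<^sub>r w \<noteq> 0"
    and "forget_dir L\<^sub>f L\<^sub>r w \<noteq> 0"
  shows "(\<forall>\<delta>. is_arg_max (\<lambda>\<delta>. grad L\<^sub>f w \<bullet> \<delta>) (\<lambda>\<delta>. \<delta> \<in> feasible L\<^sub>r \<rho> w) \<delta>
            \<longleftrightarrow> \<delta> = rosu_step L\<^sub>f L\<^sub>r \<rho> w)
       \<and> (SUP \<delta>\<in>feasible L\<^sub>r \<rho> w. grad L\<^sub>f w \<bullet> \<delta>) = \<rho> * norm (forget_dir L\<^sub>f L\<^sub>r w)"
proof -
  define q where "q = forget_dir L\<^sub>f L\<^sub>r w"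
  define F where "F = feasible L\<^sub>r \<rho> w"
  define s where "s = rosu_step L\<^sub>f L\<^sub>r \<rho> w"
  have "q \<noteq> 0"
    using assms(5) by (simp add: q_def)
  have s: "s = \<rho> *\<^sub>R ((1 / norm q) *\<^sub>R q)"
    by (simp add: s_def q_def rosu_step_def)
  \<comment> \<open>\<open>s\<close> lies on the bounding sphere, and it inherits orthogonality to
    the retain gradient from \<open>q\<close>.\<close>
  have sF: "s \<in> F"
    using \<open>\<rho> > 0\<close> \<open>q \<noteq> 0\<close> forget_dir_orthogonal[of L\<^sub>r w L\<^sub>f]
    by (simp add: F_def feasible_def s flip: q_def)
  have objective: "grad L\<^sub>f w \<bullet> \<delta> = q \<bullet> \<delta>" if "\<delta> \<in> F" for \<delta>
    using that by (simp add: F_def feasible_def q_def inner_grad_eq_inner_forget_dir)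
  have value_s: "grad L\<^sub>f w \<bullet> s = \<rho> * norm q"
    using \<open>q \<noteq> 0\<close> objective[OF sF] by (simp add: s dot_square_norm power2_eq_square)
  have upper: "grad L\<^sub>f w \<bullet> \<delta> \<le> \<rho> * norm q" if "\<delta> \<in> F" for \<delta>
    using that inner_le_on_ball[of \<delta> \<rho> q] by (simp add: objective) (simp add: F_def feasible_def)
  \<comment> \<open>A lower bound on the value suffices as the premise: any maximizer satisfies it
    by comparison with the feasible point \<open>s\<close>, whose value is
    \<open>\<rho> * norm q\<close>.\<close>
  have unique: "\<delta> = s" if "\<delta> \<in> F" "\<rho> * norm q \<le> grad L\<^sub>f w \<bullet> \<delta>" for \<delta>
    unfolding s
  proof (rule inner_ge_on_ball_imp_eq)
    show "norm \<delta> \<le> \<rho>"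
      using that(1) by (simp add: F_def feasible_def)
    show "\<rho> * norm q \<le> q \<bullet> \<delta>"
      using that by (simp add: objective)
  qed fact
  have "is_arg_max (\<lambda>\<delta>. grad L\<^sub>f w \<bullet> \<delta>) (\<lambda>\<delta>. \<delta> \<in> F) \<delta> \<longleftrightarrow> \<delta> = s" for \<delta>
    using sF upper unique value_s unfolding is_arg_max_linorder by metis
  \<comment> \<open>The upper bound is attained at \<open>s\<close>, so the supremum is a maximum;
    this also settles nonemptiness and boundedness of the set of values.\<close>
  moreover have "(SUP \<delta>\<in>F. grad L\<^sub>f w \<bullet> \<delta>) = \<rho> * norm q"
    using sF upper value_s by (intro cSup_eq_maximum) (auto intro: rev_image_eqI)
  ultimately show ?thesis
    by (simp add: F_def s_def q_def)
qed

end
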